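(* Let $A\in\mathbb{R}^{m\times n}$ have full row rank, let $B_k$ be the L-BFGS matrix described in the context, built from $S_k,Y_k\in\mathbb{R}^{n\times l}$ with $AS_k=0$, and let $$V_k = B_k^{-1}-B_k^{-1}A^\top (AB_k^{-1}A^\top)^{-1}AB_k^{-1}.$$ Let $P=I_n-A^\top(AA^\top)^{-1}A$ and $Z_k=PY_k$. Then $$V_k=\delta_k I+\begin{bmatrix}A^\top & S_k & Z_k\end{bmatrix}\begin{bmatrix}-\delta_k(AA^\top)^{-1} & 0\\ 0 & N_k\end{bmatrix}\begin{bmatrix}A\\ S_k^\top\\ Z_k^\top\end{bmatrix},$$ where $$N_k=\begin{bmatrix}T_k^{-\top}(D_k+\delta_kZ_k^\top Z_k)T_k^{-1} & -\delta_kT_k^{-\top}\\ -\delta_kT_k^{-1} & 0_{l\times l}\end{bmatrix}\in\mathbb{R}^{2l\times 2l}.$$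
   Context: Setting: minimize $f(x)$ subject to $Ax=b$, with $f:\mathbb{R}^n\to\mathbb{R}$ and gradient $g$. Iterates $x_i$ are feasible ($Ax_i=b$). Put $s_i=x_{i+1}-x_i$ and $y_i=g(x_{i+1})-g(x_i)$, so $As_i=0$. For a memory parameter $l$ with $1\le l\le k$, let $S_k=[\,s_{k-l},\dots,s_{k-1}\,]\in\mathbb{R}^{n\times l}$ and $Y_k=[\,y_{k-l},\dots,y_{k-1}\,]\in\mathbb{R}^{n\times l}$. Write $S_k^\top Y_k=L_k+D_k+\bar T_k$ with $L_k$ strictly lower triangular, $D_k$ diagonal, $\bar T_k$ strictly upper triangular, and put $T_k=D_k+\bar T_k$. Let $\gamma_k>0$, $\delta_k=1/\gamma_k$, $J_k=[\,S_k\ \ Y_k\,]$. The L-BFGS matrix is $$B_k=\gamma_k I+J_kM_kJ_k^\top,\qquad M_k=-\begin{bmatrix}\delta_kS_k^\top S_k&\delta_kL_k\\ \delta_kL_k^\top&-D_k\end{bmatrix}^{-1}.$$ Its inverse is known to be $$B_k^{-1}=\delta_kI+J_kW_kJ_k^\top,\qquad W_k=\begin{bmatrix}T_k^{-\top}(D_k+\delta_kY_k^\top Y_k)T_k^{-1}&-\delta_kT_k^{-\top}\\ -\delta_kT_k^{-1}&0_{l\times l}\end{bmatrix}.$$ Standing assumptions: the inverse defining $M_k$ exists, $D_k$ (hence $T_k$) is nonsingular, and $B_k$ is positive definite. The matrix $V_k$ is the $(1,1)$ block of the inverse of $\begin{bmatrix}B_k&A^\top\\ A&0\end{bmatrix}$.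 *)

theory Defs
  imports "HOL-Analysis.Analysis"
begin

text \<open>
  Block matrices are indexed by sum types: \<open>Inl\<close> is the first and \<open>Inr\<close> the second block
  of rows or columns.
\<close>

definition block_mat ::
  "'a^'c^'r \<Rightarrow> 'a^'d^'r \<Rightarrow> 'a^'c^'s \<Rightarrow> 'a^'d^'s \<Rightarrow> 'a^('c + 'd)^('r + 's)" where
  "block_mat A B C D = (\<chi> i j. case i of
      Inl r \<Rightarrow> (case j of Inl c \<Rightarrow> A $ r $ c | Inr d \<Rightarrow> B $ r $ d)
    | Inr s \<Rightarrow> (case j of Inl c \<Rightarrow> C $ s $ c | Inr d \<Rightarrow> D $ s $ d))"

definition hcat :: "'a^'c^'r \<Rightarrow> 'a^'d^'r \<Rightarrow> 'a^('c + 'd)^'r" where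
  "hcat A B = (\<chi> i j. case j of Inl c \<Rightarrow> A $ i $ c | Inr d \<Rightarrow> B $ i $ d)"

definition vcat :: "'a^'c^'r \<Rightarrow> 'a^'c^'s \<Rightarrow> 'a^'c^('r + 's)" where
  "vcat A B = (\<chi> i j. case i of Inl r \<Rightarrow> A $ r $ j | Inr s \<Rightarrow> B $ s $ j)"

definition strict_lower_part :: "'a::zero^('l::{finite,linorder})^('l::{finite,linorder})
    \<Rightarrow> 'a^('l::{finite,linorder})^('l::{finite,linorder})" where
  "strict_lower_part X = (\<chi> i j. if j < i then X $ i $ j else 0)"

definition diag_part :: "'a::zero^'l^'l \<Rightarrow> 'a^'l^'l" where
  "diag_part X = (\<chi> i j. if i = j then X $ i $ j else 0)"

definition strict_upper_part :: "'a::zero^('l::{finite,linorder})^('l::{finite,linorder})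
    \<Rightarrow> 'a^('l::{finite,linorder})^('l::{finite,linorder})" where
  "strict_upper_part X = (\<chi> i j. if i < j then X $ i $ j else 0)"

definition pos_def_mat :: "real^'n^'n \<Rightarrow> bool" where
  "pos_def_mat X \<longleftrightarrow> transpose X = X \<and> (\<forall>x. x \<noteq> 0 \<longrightarrow> 0 < x \<bullet> (X *v x))"

end

theory Submission
  imports Defs
begin

text \<open>
  The matrix \<open>V\<close> is the first block of the inverse of \<open>block_mat B (transpose A) A 0\<close>.
  Hence it is characterised by two equations: a matrix \<open>X\<close> with \<open>A ** X = 0\<close> and
  \<open>B ** X + transpose A ** W = mat 1\<close> for some multiplier \<open>W\<close> must equal \<open>V\<close>
  (\<open>saddle_point_solution_unique\<close>). The proof verifies both for the claimed right-hand side,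
  without ever computing the inverse of \<open>B\<close>.

  Since \<open>mat 1 - transpose A ** matrix_inv (A ** transpose A) ** A = P\<close>, the right-hand side is
  \<open>X = \<delta> *\<^sub>R P + hcat S Z ** N ** vcat (transpose S) (transpose Z)\<close>, and \<open>A ** X = 0\<close> is clear
  from \<open>A ** P = 0\<close>, \<open>A ** S = 0\<close> and \<open>A ** Z = 0\<close>. The second equation rests on the identity
  \<open>B ** X = P + (Y - Z) ** matrix_inv T ** transpose S\<close> (\<open>lbfgs_mult_projected_inverse\<close>). As
  \<open>Y - Z = Y - P ** Y\<close> and \<open>mat 1 - P\<close> both have the form \<open>transpose A ** _\<close>, what separates
  \<open>B ** X\<close> from the identity matrix is a multiple of \<open>transpose A\<close>, as required.

  Positive definiteness of \<open>B\<close> and the full row rank of \<open>A\<close> make the two Gram-like matrices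
  \<open>A ** transpose A\<close> and \<open>A ** matrix_inv B ** transpose A\<close> invertible.
\<close>

section \<open>Matrix algebra\<close>

lemma matrix_mult_add_left: "(X + Y) ** W = X ** W + Y ** (W :: real^'p^'q)"
  by (vector matrix_matrix_mult_def sum.distrib algebra_simps)

lemma matrix_mult_diff_left: "(X - Y) ** W = X ** W - Y ** (W :: real^'p^'q)"
  by (vector matrix_matrix_mult_def sum_subtractf algebra_simps)

lemma matrix_mult_diff_right: "W ** (X - Y) = W ** X - W ** (Y :: real^'p^'q)"
  by (vector matrix_matrix_mult_def sum_subtractf algebra_simps)

lemma matrix_mult_minus_left: "(- X) ** W = - (X ** (W :: real^'p^'q))"
  by (vector matrix_matrix_mult_def sum_negf)

lemma matrix_mult_minus_right: "W ** (- X) = - (W ** (X :: real^'p^'q))"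
  by (vector matrix_matrix_mult_def sum_negf)

lemma matrix_mult_scaleR_left: "(c *\<^sub>R X) ** W = c *\<^sub>R (X ** (W :: real^'p^'q))"
  by (vector matrix_matrix_mult_def sum_distrib_left mult.assoc)

lemma matrix_mult_scaleR_right: "W ** (c *\<^sub>R X) = c *\<^sub>R (W ** (X :: real^'p^'q))"
  by (vector matrix_matrix_mult_def sum_distrib_left mult.left_commute)

lemma matrix_mult_zero_left: "0 ** (W :: real^'p^'q) = 0"
  by (vector matrix_matrix_mult_def)

lemma matrix_mult_zero_right: "(W :: real^'p^'q) ** 0 = 0"
  by (vector matrix_matrix_mult_def)

lemmas matrix_mult_linear =
  matrix_add_ldistrib matrix_mult_add_left matrix_mult_diff_left matrix_mult_diff_right
  matrix_mult_minus_left matrix_mult_minus_right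
  matrix_mult_scaleR_left matrix_mult_scaleR_right
  matrix_mult_zero_left matrix_mult_zero_right

lemma transpose_add: "transpose (X + Y) = transpose X + transpose Y"
  by (vector transpose_def)

lemma transpose_diff: "transpose (X - Y) = transpose X - transpose (Y :: real^'p^'q)"
  by (vector transpose_def)

lemma matrix_inv_mult_left: "invertible X \<Longrightarrow> matrix_inv X ** X = mat 1"
  and matrix_inv_mult_right: "invertible X \<Longrightarrow> X ** matrix_inv X = mat 1"
  unfolding invertible_def matrix_inv_def by (drule someI_ex, blast)+

text \<open>
  Cancellation inside a product bracketed to the right.
\<close>

lemma matrix_inv_cancel_left: "invertible X \<Longrightarrow> matrix_inv X ** (X ** W) = W"
  and matrix_inv_cancel_right: "invertible X \<Longrightarrow> X ** (matrix_inv X ** W) = W"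
  for X :: "real^'p^'p"
  by (simp_all add: matrix_mul_assoc matrix_inv_mult_left matrix_inv_mult_right)

lemma matrix_inv_unique: "matrix_inv X = Y" if "Y ** X = mat 1" for X :: "real^'p^'p"
  by (metis invertible_left_inverse matrix_inv_cancel_right matrix_mul_assoc matrix_mul_lid
      matrix_mul_rid that matrix_inv_mult_right)

lemma transpose_matrix_inv_symmetric:
  fixes X :: "real^'p^'p"
  assumes "invertible X" and "transpose X = X"
  shows "transpose (matrix_inv X) = matrix_inv X"
  by (metis assms matrix_inv_mult_right matrix_inv_unique matrix_transpose_mul transpose_mat)

section \<open>Block matrices\<close>

lemma sum_UNIV_Plus:
  "(\<Sum>k\<in>(UNIV :: ('p::finite + 'q::finite) set). f k) = (\<Sum>i\<in>UNIV. f (Inl i)) + (\<Sum>j\<in>UNIV. f (Inr j))"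
  by (subst UNIV_Plus_UNIV[symmetric], subst sum.Plus) (simp_all add: o_def)

lemma hcat_mult_vcat: "hcat A B ** vcat C D = A ** C + B ** (D :: real^'p^'q)"
  by (simp add: vec_eq_iff hcat_def vcat_def matrix_matrix_mult_def sum_UNIV_Plus)

lemma block_mat_mult_vcat:
  "block_mat A B C D ** vcat E F = vcat (A ** E + B ** F) (C ** E + D ** (F :: real^'p^'q))"
  by (simp add: vec_eq_iff block_mat_def vcat_def matrix_matrix_mult_def sum_UNIV_Plus
      split: sum.split)

lemma vcat_mult: "vcat A B ** W = vcat (A ** W) (B ** (W :: real^'p^'q))"
  by (simp add: vec_eq_iff vcat_def matrix_matrix_mult_def split: sum.split)

lemma mult_hcat: "W ** hcat A B = hcat (W ** A) (W ** (B :: real^'p^'q))"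
  by (simp add: vec_eq_iff hcat_def matrix_matrix_mult_def split: sum.split)

lemma hcat_zero: "hcat 0 0 = 0"
  by (simp add: vec_eq_iff hcat_def split: sum.split)

lemma transpose_hcat: "transpose (hcat A B) = vcat (transpose A) (transpose B)"
  by (simp add: vec_eq_iff hcat_def vcat_def transpose_def split: sum.split)

section \<open>Invertibility\<close>

lemma pos_def_mat_invertible:
  assumes "pos_def_mat X"
  shows "invertible X"
proof -
  have "x = 0" if "X *v x = 0" for x
    using assms that unfolding pos_def_mat_def by (metis inner_zero_right less_irrefl)
  then show ?thesis
    by (simp add: invertible_left_inverse matrix_left_invertible_ker)
qed

text \<open>
  With \<open>x = X *v u\<close>, both \<open>X\<close> at \<open>u\<close> and its inverse at \<open>x\<close> have the quadratic form \<open>x \<bullet> u\<close>.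
\<close>

lemma pos_def_mat_matrix_inv:
  assumes "pos_def_mat X"
  shows "pos_def_mat (matrix_inv X)"
  unfolding pos_def_mat_def
proof (intro conjI allI impI)
  have inv: "invertible X" and sym: "transpose X = X"
    using assms by (auto simp: pos_def_mat_invertible pos_def_mat_def)
  show "transpose (matrix_inv X) = matrix_inv X"
    by (rule transpose_matrix_inv_symmetric[OF inv sym])
  fix x :: "real^'a" assume "x \<noteq> 0"
  define u where "u = matrix_inv X *v x"
  have x: "X *v u = x"
    by (simp add: u_def matrix_vector_mul_assoc matrix_inv_mult_right[OF inv])
  with \<open>x \<noteq> 0\<close> have "u \<noteq> 0" by auto
  then have "0 < u \<bullet> (X *v u)" using assms by (simp add: pos_def_mat_def)
  then show "0 < x \<bullet> (matrix_inv X *v x)"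
    by (simp add: x u_def[symmetric] inner_commute)
qed

lemma pos_def_mat_one: "pos_def_mat (mat 1)"
  by (simp add: pos_def_mat_def)

text \<open>
  Full row rank makes \<open>transpose A\<close> injective, so the quadratic form of \<open>A ** H ** transpose A\<close>
  at \<open>x\<close> is that of \<open>H\<close> at the nonzero vector \<open>transpose A *v x\<close>.
\<close>

lemma pos_def_mat_congruence:
  fixes A :: "real^'n^'m"
  assumes "pos_def_mat H" and "rank A = CARD('m)"
  shows "pos_def_mat (A ** H ** transpose A)"
  unfolding pos_def_mat_def
proof (intro conjI allI impI)
  show "transpose (A ** H ** transpose A) = A ** H ** transpose A"
    using assms(1) by (simp add: pos_def_mat_def matrix_transpose_mul matrix_mul_assoc)
  fix x :: "real^'m" assume "x \<noteq> 0"
  have "inj ((*v) (transpose A))"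
    using assms(2) by (simp only: full_rank_injective[symmetric] rank_transpose)
  then have "transpose A *v x \<noteq> 0"
    using \<open>x \<noteq> 0\<close> by (metis injD matrix_vector_mult_0_right)
  then have "0 < (transpose A *v x) \<bullet> (H *v (transpose A *v x))"
    using assms(1) unfolding pos_def_mat_def by blast
  also have "\<dots> = x \<bullet> ((A ** H ** transpose A) *v x)"
    by (simp add: dot_lmul_matrix flip: matrix_vector_mul_assoc)
  finally show "0 < x \<bullet> ((A ** H ** transpose A) *v x)" .
qed

text \<open>
  If \<open>T x = 0\<close> with \<open>x \<noteq> 0\<close>, take the last index \<open>i\<close> with \<open>x $ i \<noteq> 0\<close>: row \<open>i\<close> of the
  system reads \<open>T $ i $ i * x $ i = 0\<close>.
\<close>

lemma invertible_upper_triangular: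
  fixes T :: "real^('l::{finite,linorder})^('l::{finite,linorder})"
  assumes upper: "\<And>i j. j < i \<Longrightarrow> T $ i $ j = 0"
    and diag: "\<And>i. T $ i $ i \<noteq> 0"
  shows "invertible T"
proof -
  have "x = 0" if Tx: "T *v x = 0" for x
  proof (rule ccontr)
    assume "x \<noteq> 0"
    then have ne: "{i. x $ i \<noteq> 0} \<noteq> {}" by (auto simp: vec_eq_iff)
    define i where "i = Max {i. x $ i \<noteq> 0}"
    have xi: "x $ i \<noteq> 0" using Max_in[OF _ ne] by (simp add: i_def)
    have above: "x $ j = 0" if "i < j" for j
      using that Max_ge[of "{i. x $ i \<noteq> 0}" j] unfolding i_def
      by (meson finite leD mem_Collect_eq)
    have "0 = (\<Sum>j\<in>UNIV. T $ i $ j * x $ j)"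
      using Tx by (simp add: vec_eq_iff matrix_vector_mult_def)
    also have "\<dots> = (\<Sum>j\<in>UNIV. if j = i then T $ i $ i * x $ i else 0)"
      by (rule sum.cong) (use upper above in \<open>auto, metis linorder_neqE\<close>)
    finally show False using diag[of i] xi by simp
  qed
  then show ?thesis
    by (simp add: invertible_left_inverse matrix_left_invertible_ker)
qed

section \<open>The first block of the inverse of a saddle-point matrix\<close>

text \<open>
  The two equations say that \<open>(X, W)\<close> is the first block column of the inverse of
  \<open>block_mat B (transpose A) A 0\<close>. The second of them expresses \<open>X\<close> through \<open>W\<close>; inserting
  this into \<open>A ** X = 0\<close> leaves a system for \<open>W\<close> with the Schur complement as its matrix.
\<close>

lemma saddle_point_solution_unique:
  fixes A :: "real^'n^'m" and B X :: "real^'n^'n" and W :: "real^'n^'m"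
  assumes B: "invertible B"
    and AA: "invertible (A ** matrix_inv B ** transpose A)"
    and AX: "A ** X = 0"
    and BX: "B ** X + transpose A ** W = mat 1"
  shows "X = matrix_inv B - matrix_inv B ** transpose A
               ** matrix_inv (A ** matrix_inv B ** transpose A) ** A ** matrix_inv B"
proof -
  let ?H = "matrix_inv B" and ?K = "A ** matrix_inv B ** transpose A"
  have "B ** X = mat 1 - transpose A ** W"
    using BX by (simp add: eq_diff_eq)
  then have "?H ** (B ** X) = ?H ** (mat 1 - transpose A ** W)" by simp
  then have X: "X = ?H - ?H ** transpose A ** W"
    unfolding matrix_inv_cancel_left[OF B] by (simp add: matrix_mult_diff_right matrix_mul_assoc)
  then have "A ** ?H - ?K ** W = 0"
    using AX by (simp add: matrix_mult_diff_right matrix_mul_assoc)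
  then have "matrix_inv ?K ** (A ** ?H) = matrix_inv ?K ** (?K ** W)" by simp
  then have "W = matrix_inv ?K ** (A ** ?H)"
    by (simp only: matrix_inv_cancel_left[OF AA])
  then show ?thesis
    using X by (simp add: matrix_mul_assoc)
qed

section \<open>The L-BFGS matrix and its projected inverse\<close>

text \<open>
  For \<open>P = mat 1\<close> (so \<open>Z = Y\<close>) this is the compact formula for the inverse of the L-BFGS
  matrix; for a general symmetric idempotent \<open>P\<close> fixing \<open>S\<close> the same computation goes through,
  because \<open>transpose S\<close> cannot tell \<open>Z\<close> from \<open>Y\<close> and \<open>transpose Y\<close> sees only \<open>Z\<close>. The
  inverse of \<open>Q\<close> is met in a single product only, where the solution of the linear system
  can be written down: with \<open>U\<close> and \<open>R\<close> the two block rows of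
  \<open>N ** vcat (transpose S) (transpose Z)\<close> up to the factor \<open>- \<delta>\<close> in the second,
  it is \<open>vcat (\<gamma> *\<^sub>R U) (- R)\<close>.
\<close>

lemma lbfgs_mult_projected_inverse:
  fixes S Y Z :: "real^'l^'n" and L D T :: "real^'l^'l" and P :: "real^'n^'n"
  assumes scale: "\<gamma> * \<delta> = 1"
    and STY: "transpose S ** Y = L + T"
    and T_inv: "invertible T"
    and Q_inv: "invertible Q"
    and Q_eq: "Q = block_mat (\<delta> *\<^sub>R (transpose S ** S)) (\<delta> *\<^sub>R L) (\<delta> *\<^sub>R transpose L) (- D)"
    and N_eq: "N = block_mat
        (transpose (matrix_inv T) ** (D + \<delta> *\<^sub>R (transpose Z ** Z)) ** matrix_inv T)
        (- (\<delta> *\<^sub>R transpose (matrix_inv T)))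
        (- (\<delta> *\<^sub>R matrix_inv T))
        0"
    and P_sym: "transpose P = P" and P_idem: "P ** P = P" and PS: "P ** S = S"
    and Z_eq: "Z = P ** Y"
  shows "(\<gamma> *\<^sub>R mat 1 - hcat S Y ** matrix_inv Q ** transpose (hcat S Y))
           ** (\<delta> *\<^sub>R P + hcat S Z ** N ** vcat (transpose S) (transpose Z))
         = P + (Y - Z) ** matrix_inv T ** transpose S"
proof -
  let ?S' = "transpose S" and ?Y' = "transpose Y" and ?Z' = "transpose Z"
  define R where "R = matrix_inv T ** ?S'"
  define U where "U = transpose (matrix_inv T) ** ((D + \<delta> *\<^sub>R (?Z' ** Z)) ** R - \<delta> *\<^sub>R ?Z')"
  define X where "X = \<delta> *\<^sub>R P + hcat S Z ** N ** vcat ?S' ?Z'"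
  have X: "X = \<delta> *\<^sub>R P + S ** U - \<delta> *\<^sub>R (Z ** R)"
    by (simp add: X_def N_eq U_def R_def hcat_mult_vcat block_mat_mult_vcat matrix_mult_linear
        flip: matrix_mul_assoc)
  have SP: "?S' ** P = ?S'" using PS P_sym by (metis matrix_transpose_mul)
  have YP: "?Y' ** P = ?Z'" using P_sym by (simp add: Z_eq matrix_transpose_mul)
  have SZ: "?S' ** Z = L + T" using SP STY by (simp add: Z_eq matrix_mul_assoc)
  have YZ: "?Y' ** Z = ?Z' ** Z"
    using YP P_idem by (metis Z_eq matrix_mul_assoc)
  have YS: "?Y' ** S = transpose L + transpose T"
    using STY by (metis matrix_transpose_mul transpose_add transpose_transpose)
  have TR: "T ** R = ?S'"
    by (simp add: R_def matrix_inv_cancel_right[OF T_inv])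
  have "transpose T ** transpose (matrix_inv T) = mat 1"
    by (metis T_inv matrix_inv_mult_left matrix_transpose_mul transpose_mat)
  then have TU: "transpose T ** U = (D + \<delta> *\<^sub>R (?Z' ** Z)) ** R - \<delta> *\<^sub>R ?Z'"
    by (simp add: U_def matrix_mul_assoc)
  have SX: "?S' ** X = ?S' ** S ** U - \<delta> *\<^sub>R (L ** R)"
    by (simp add: X matrix_mult_linear SP matrix_mul_assoc SZ TR algebra_simps)
  have YX: "?Y' ** X = transpose L ** U + D ** R"
    by (simp add: X matrix_mult_linear YP matrix_mul_assoc YZ YS TU algebra_simps)
  \<comment> \<open>The \<open>L\<close> part of \<open>transpose S ** Y\<close> is all that survives in \<open>SX\<close> and \<open>YX\<close>: the \<open>T\<close> part
      cancels against the inverses in \<open>R\<close> and \<open>U\<close>. This is exactly the shape of \<open>Q\<close>.\<close>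
  have "transpose (hcat S Y) ** X = Q ** vcat (\<gamma> *\<^sub>R U) (- R)"
    using scale
    by (simp add: transpose_hcat vcat_mult SX YX Q_eq block_mat_mult_vcat matrix_mult_linear
        mult.commute)
  then have "matrix_inv Q ** (transpose (hcat S Y) ** X) = vcat (\<gamma> *\<^sub>R U) (- R)"
    by (simp add: matrix_inv_cancel_left[OF Q_inv])
  then have "(\<gamma> *\<^sub>R mat 1 - hcat S Y ** matrix_inv Q ** transpose (hcat S Y)) ** X
      = \<gamma> *\<^sub>R X - (\<gamma> *\<^sub>R (S ** U) - Y ** R)"
    by (simp add: matrix_mult_linear hcat_mult_vcat flip: matrix_mul_assoc)
  also have "\<dots> = P + (Y - Z) ** R"
    using scale by (simp add: X matrix_mult_linear algebra_simps)
  finally show ?thesis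
    by (simp add: X_def R_def matrix_mul_assoc)
qed

theorem lemma1:
  fixes A :: "real^'n^'m"
    and S Y Z :: "real^('l::{finite,linorder})^'n"
    and \<gamma> \<delta> :: real
    and L D T\<^sub>u T :: "real^('l::{finite,linorder})^('l::{finite,linorder})"
    and Q M N :: "real^(('l::{finite,linorder}) + ('l::{finite,linorder}))^(('l::{finite,linorder}) + ('l::{finite,linorder}))"
    and J :: "real^(('l::{finite,linorder}) + ('l::{finite,linorder}))^'n"
    and B V P :: "real^'n^'n"
  assumes full_row_rank: "rank A = CARD('m)"
    and AS: "A ** S = 0"
    and \<gamma>_pos: "\<gamma> > 0"
    and \<delta>_eq: "\<delta> = 1 / \<gamma>"
    and L_eq: "L = strict_lower_part (transpose S ** Y)"
    and D_eq: "D = diag_part (transpose S ** Y)"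
    and T\<^sub>u_eq: "T\<^sub>u = strict_upper_part (transpose S ** Y)"
    and T_eq: "T = D + T\<^sub>u"
    and J_eq: "J = hcat S Y"
    and Q_eq: "Q = block_mat (\<delta> *\<^sub>R (transpose S ** S)) (\<delta> *\<^sub>R L)
                             (\<delta> *\<^sub>R transpose L)           (- D)"
    and Q_inv: "invertible Q"
    and M_eq: "M = - matrix_inv Q"
    and B_eq: "B = \<gamma> *\<^sub>R mat 1 + J ** M ** transpose J"
    and D_inv: "invertible D"
    and B_pos_def: "pos_def_mat B"
    and V_eq: "V = matrix_inv B - matrix_inv B ** transpose A
                 ** matrix_inv (A ** matrix_inv B ** transpose A) ** A ** matrix_inv B"
    and P_eq: "P = mat 1 - transpose A ** matrix_inv (A ** transpose A) ** A"
    and Z_eq: "Z = P ** Y"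
    and N_eq: "N = block_mat
        (transpose (matrix_inv T) ** (D + \<delta> *\<^sub>R (transpose Z ** Z)) ** matrix_inv T)
        (- (\<delta> *\<^sub>R transpose (matrix_inv T)))
        (- (\<delta> *\<^sub>R matrix_inv T))
        0"
  shows "V = \<delta> *\<^sub>R mat 1
    + hcat (transpose A) (hcat S Z)
      ** block_mat (- (\<delta> *\<^sub>R matrix_inv (A ** transpose A))) 0 0 N
      ** vcat A (vcat (transpose S) (transpose Z))"
proof -
  define G where "G = matrix_inv (A ** transpose A)"
  define R where "R = matrix_inv T ** transpose S"
  have AA_inv: "invertible (A ** transpose A)"
    using pos_def_mat_congruence[OF pos_def_mat_one full_row_rank]
    by (simp add: pos_def_mat_invertible)
  have G_sym: "transpose G = G"
    unfolding G_def
    by (rule transpose_matrix_inv_symmetric[OF AA_inv]) (simp add: matrix_transpose_mul)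
  have AA_G: "A ** (transpose A ** (G ** W)) = W" for W :: "real^'k^'m"
    using matrix_inv_cancel_right[OF AA_inv, of W] by (simp add: G_def matrix_mul_assoc)
  have P: "P = mat 1 - transpose A ** (G ** A)"
    by (simp add: P_eq G_def matrix_mul_assoc)
  have AP: "A ** P = 0"
    by (simp add: P matrix_mult_linear AA_G)
  have P_sym: "transpose P = P"
    by (simp add: P transpose_diff matrix_transpose_mul G_sym matrix_mul_assoc)
  have P_idem: "P ** P = P"
    using AP by (subst (1) P) (simp add: matrix_mult_linear flip: matrix_mul_assoc)
  have PS: "P ** S = S"
    by (simp add: P matrix_mult_linear AS flip: matrix_mul_assoc)
  have AZ: "A ** Z = 0"
    by (simp add: Z_eq matrix_mul_assoc AP matrix_mult_linear)
  have STY: "transpose S ** Y = L + T"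
    by (auto simp: L_eq T_eq D_eq T\<^sub>u_eq strict_lower_part_def diag_part_def
        strict_upper_part_def vec_eq_iff)
  have "det D = (\<Prod>i\<in>UNIV. D $ i $ i)"
    by (rule det_diagonal) (simp add: D_eq diag_part_def)
  then have D_diag: "D $ i $ i \<noteq> 0" for i
    using D_inv by (simp add: invertible_det_nz)
  have T_inv: "invertible T"
  proof (rule invertible_upper_triangular)
    show "T $ i $ j = 0" if "j < i" for i j
      using that by (auto simp: T_eq D_eq T\<^sub>u_eq diag_part_def strict_upper_part_def)
    show "T $ i $ i \<noteq> 0" for i
      using D_diag[of i] by (simp add: T_eq T\<^sub>u_eq strict_upper_part_def)
  qed
  define X where "X = \<delta> *\<^sub>R P + hcat S Z ** N ** vcat (transpose S) (transpose Z)"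
  have scale: "\<gamma> * \<delta> = 1" using \<gamma>_pos \<delta>_eq by simp
  have B: "B = \<gamma> *\<^sub>R mat 1 - hcat S Y ** matrix_inv Q ** transpose (hcat S Y)"
    by (simp add: B_eq M_eq J_eq matrix_mult_linear)
  have BX: "B ** X = P + (Y - Z) ** R"
    unfolding B X_def R_def matrix_mul_assoc
    by (rule lbfgs_mult_projected_inverse[OF scale STY T_inv Q_inv Q_eq N_eq P_sym P_idem PS Z_eq])
  \<comment> \<open>The multiplier is read off from \<open>mat 1 - P = transpose A ** G ** A\<close> and
      \<open>Y - Z = transpose A ** G ** A ** Y\<close>.\<close>
  have "B ** X + transpose A ** (G ** A - G ** A ** Y ** R) = mat 1"
    by (simp add: BX Z_eq P matrix_mult_linear matrix_mul_assoc)
  moreover have "A ** X = 0"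
    by (simp add: X_def matrix_mult_linear matrix_mul_assoc mult_hcat AP AS AZ hcat_zero)
  ultimately have "V = X"
    unfolding V_eq
    by (intro saddle_point_solution_unique[symmetric] pos_def_mat_invertible B_pos_def
        pos_def_mat_congruence pos_def_mat_matrix_inv full_row_rank)
  also have "X = \<delta> *\<^sub>R mat 1
    + hcat (transpose A) (hcat S Z)
      ** block_mat (- (\<delta> *\<^sub>R G)) 0 0 N
      ** vcat A (vcat (transpose S) (transpose Z))"
    by (simp add: X_def P hcat_mult_vcat block_mat_mult_vcat matrix_mult_linear
        scaleR_diff_right flip: matrix_mul_assoc)
  finally show ?thesis by (simp only: G_def)
qed

end
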